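(* Let $A_{\bar c\bar o}\in\mathbb R^{2n_2\times2n_2}$ be the system matrix of the $\bar c\bar o$ subsystem $\dot{\boldsymbol x}_{\bar c\bar o}=A_{\bar c\bar o}\boldsymbol x_{\bar c\bar o}$ of the Kalman canonical form of a quantum linear system, and let $\sigma(A_{\bar c\bar o})$ denote its set of eigenvalues. If $\lambda\in\sigma(A_{\bar c\bar o})$, then $-\lambda,\lambda^*,-\lambda^*\in\sigma(A_{\bar c\bar o})$.
   Context: Notation: $X^{\#}$ is the entrywise complex conjugate, $X^\dag=(X^{\#})^\top$; $\lambda^*$ is the complex conjugate of $\lambda$; $J_k=\mathrm{diag}(I_k,-I_k)$; $X^\flat=J_rX^\dag J_k$ for $X\in\mathbb C^{2k\times2r}$; $\Delta(U,V)=\begin{bmatrix} U & V \\ U^{\#} & V^{\#} \end{bmatrix}$; $V_k=\frac1{\sqrt2}\begin{bmatrix} I_k & I_k \\ -\imath I_k & \imath I_k \end{bmatrix}$. Quantum linear system with $n$ oscillators and $m$ fields: $\mathcal C=\Delta(C_-,C_+)$, $\mathcal B=-\mathcal C^\flat$, $\mathcal A=-\imath J_n\Omega-\frac12\mathcal C^\flat\mathcal C$, with $C_\pm\in\mathbb C^{m\times n}$ and $\Omega=\Delta(\Omega_-,\Omega_+)\in\mathbb C^{2n\times2n}$ Hermitian. Kalman canonical form ($n=n_1+n_2+n_3$): there are $Z_j\in\mathbb C^{n\times n_j}$ ($j=1,2,3$) such that $$T=\begin{bmatrix} Z_3 & 0 & Z_1 & 0 & Z_2 & 0 \\ 0 &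 Z_3^{\#} & 0 & Z_1^{\#} & 0 & Z_2^{\#} \end{bmatrix}$$ is unitary with $T^\dag J_nT=\mathrm{diag}(J_{n_3},J_{n_1},J_{n_2})$; and, with $n_3=n_a+n_b$ and $$\Pi=\begin{bmatrix} I_{n_a} & 0 & 0 & 0 \\ 0 & 0 & 0 & -I_{n_b} \\ 0 & 0 & I_{n_a} & 0 \\ 0 & I_{n_b} & 0 & 0 \end{bmatrix},\qquad \tilde V_n=\mathrm{diag}(\Pi V_{n_3},V_{n_1},V_{n_2}),\qquad \hat T=T\tilde V_n^\dag,$$ the matrices $\bar A=\hat T^\dag\mathcal A\hat T$, $\bar B=\hat T^\dag\mathcal BV_m^\dag$, $\bar C=V_m\mathcal C\hat T$ are real and, in the partition $\boldsymbol q_h,\boldsymbol p_h,\boldsymbol x_{co},\boldsymbol x_{\bar c\bar o}$ with lengths $n_3,n_3,2n_1,2n_2$, $$\bar A=\begin{bmatrix} A_h^{11} & A_h^{12} & A_{12} & A_{13} \\ 0 & A_h^{22} & 0 & 0 \\ 0 & A_{21} & A_{co} & 0 \\ 0 & A_{31} & 0 & A_{\bar c\bar o} \end{bmatrix},\quad \bar B=\begin{bmatrix} B_h \\ 0 \\ B_{co} \\ 0 \end{bmatrix},\quad \bar C=\begin{bmatrix} 0 & C_h & C_{co} & 0 \end{bmatrix},$$ with the controllable subspace of $(\bar A,\bar B)$ the span of the $\boldsymbol q_h,\boldsymbol x_{co}$ coordinates and the unobservable subspace of $(\bar A,\bar C)$ the span of the $\boldsymbol q_h,\boldsymbol x_{\bar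 c\bar o}$ coordinates. *)

theory Defs
  imports "Jordan_Normal_Form.Spectral_Radius"
begin

text \<open>The dimensions occurring in the canonical form may be zero, so all matrices are
  carrier-based matrices. For complex matrices, \<open>mat_adjoint\<close> is the conjugate transpose and
  \<open>map_mat cnj\<close> the entrywise conjugate.\<close>

text \<open>The neutral elements \<open>0\<^sub>m 0 0\<close> below are harmless, because \<open>four_block_mat\<close> reads off the
  dimensions from the two diagonal blocks only. The row count of a block row is that of its
  first block, and the column count is that of the first block row.\<close>

definition append_cols :: "'a :: zero mat \<Rightarrow> 'a mat \<Rightarrow> 'a mat" where
  "append_cols A B = four_block_mat A B (0\<^sub>m 0 (dim_col A)) (0\<^sub>m 0 (dim_col B))"

definition block_mat :: "'a :: zero mat list list \<Rightarrow> 'a mat" where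
  "block_mat Bs =
     foldr append_rows (map (\<lambda>row. foldr append_cols row (0\<^sub>m 0 0)) Bs) (0\<^sub>m 0 0)"

definition hermitian_mat :: "complex mat \<Rightarrow> bool" where
  "hermitian_mat X \<longleftrightarrow> mat_adjoint X = X"

definition unitary_mat :: "complex mat \<Rightarrow> bool" where
  "unitary_mat U \<longleftrightarrow>
     square_mat U \<and> inverts_mat U (mat_adjoint U) \<and> inverts_mat (mat_adjoint U) U"

definition J_mat :: "nat \<Rightarrow> complex mat" where
  "J_mat k = diag_block_mat [1\<^sub>m k, - (1\<^sub>m k)]"

text \<open>\<open>X\<^sup>\<flat> = J\<^sub>r X\<^sup>\<dagger> J\<^sub>k\<close> for a \<open>2k \<times> 2r\<close> matrix \<open>X\<close>.\<close>

definition flat :: "complex mat \<Rightarrow> complex mat" where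
  "flat X = J_mat (dim_col X div 2) * mat_adjoint X * J_mat (dim_row X div 2)"

text \<open>Two conventions for \<open>\<Delta>(U, V)\<close>: in \<open>Delta\<close> the second block row is \<open>(U\<^sup>#, V\<^sup>#)\<close>, while in the
  usual doubled-up matrix \<open>Delta_doubled\<close> it is \<open>(V\<^sup>#, U\<^sup>#)\<close>. The latter is the one that describes
  a linear map acting on annihilation operators stacked on top of creation operators.\<close>

definition Delta :: "complex mat \<Rightarrow> complex mat \<Rightarrow> complex mat" where
  "Delta U V = four_block_mat U V (map_mat cnj U) (map_mat cnj V)"

definition Delta_doubled :: "complex mat \<Rightarrow> complex mat \<Rightarrow> complex mat" where
  "Delta_doubled U V = four_block_mat U V (map_mat cnj V) (map_mat cnj U)"

definition V_mat :: "nat \<Rightarrow> complex mat" where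
  "V_mat k = complex_of_real (1 / sqrt 2) \<cdot>\<^sub>m
     block_mat [[1\<^sub>m k,            1\<^sub>m k],
                [(- \<i>) \<cdot>\<^sub>m 1\<^sub>m k, \<i> \<cdot>\<^sub>m 1\<^sub>m k]]"

definition qls_A :: "nat \<Rightarrow> complex mat \<Rightarrow> complex mat \<Rightarrow> complex mat" where
  "qls_A n \<Omega> C = (- \<i>) \<cdot>\<^sub>m (J_mat n * \<Omega>) - (1 / 2) \<cdot>\<^sub>m (flat C * C)"

definition qls_B :: "complex mat \<Rightarrow> complex mat" where
  "qls_B C = - flat C"

definition kalman_T ::
  "nat \<Rightarrow> nat \<Rightarrow> nat \<Rightarrow> nat \<Rightarrow> complex mat \<Rightarrow> complex mat \<Rightarrow> complex mat \<Rightarrow> complex mat" where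
  "kalman_T n n1 n2 n3 Z1 Z2 Z3 =
     block_mat [[Z3, 0\<^sub>m n n3, Z1, 0\<^sub>m n n1, Z2, 0\<^sub>m n n2],
                [0\<^sub>m n n3, map_mat cnj Z3, 0\<^sub>m n n1, map_mat cnj Z1, 0\<^sub>m n n2, map_mat cnj Z2]]"

definition Pi_mat :: "nat \<Rightarrow> nat \<Rightarrow> complex mat" where
  "Pi_mat na nb =
     block_mat [[1\<^sub>m na,    0\<^sub>m na nb, 0\<^sub>m na na, 0\<^sub>m na nb],
                [0\<^sub>m nb na, 0\<^sub>m nb nb, 0\<^sub>m nb na, - (1\<^sub>m nb)],
                [0\<^sub>m na na, 0\<^sub>m na nb, 1\<^sub>m na,    0\<^sub>m na nb],
                [0\<^sub>m nb na, 1\<^sub>m nb,    0\<^sub>m nb na, 0\<^sub>m nb nb]]"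

definition V_tilde :: "nat \<Rightarrow> nat \<Rightarrow> nat \<Rightarrow> nat \<Rightarrow> complex mat" where
  "V_tilde n1 n2 na nb = diag_block_mat [Pi_mat na nb * V_mat (na + nb), V_mat n1, V_mat n2]"

definition vec_span :: "nat \<Rightarrow> 'a :: field vec set \<Rightarrow> 'a vec set" where
  "vec_span N S = LinearCombinations.module.span class_ring (module_vec TYPE('a) N) S"

text \<open>Column space of \<open>[B, A B, \<dots>, A\<^bsup>N-1\<^esup> B]\<close>.\<close>

definition controllable_subspace :: "'a :: field mat \<Rightarrow> 'a mat \<Rightarrow> 'a vec set" where
  "controllable_subspace A B =
     vec_span (dim_row A) (\<Union>k<dim_row A. set (cols (A ^\<^sub>m k * B)))"

text \<open>Kernel of the matrix with block rows \<open>C, C A, \<dots>, C A\<^bsup>N-1\<^esup>\<close>.\<close>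

definition unobservable_subspace :: "'a :: field mat \<Rightarrow> 'a mat \<Rightarrow> 'a vec set" where
  "unobservable_subspace A C =
     {v \<in> carrier_vec (dim_row A). \<forall>k<dim_row A. C * A ^\<^sub>m k *\<^sub>v v = 0\<^sub>v (dim_row C)}"

definition coordinate_subspace :: "nat \<Rightarrow> nat set \<Rightarrow> 'a :: field vec set" where
  "coordinate_subspace N I = vec_span N (unit_vec N ` I)"

end

(* Let S consist of the columns of T belonging to the last 2 n2 coordinates. The vanishing last
   block of C_bar gives C S = 0, so the dissipative part of A does not contribute to A_ncno, and
   T^dagger J T = diag(J, J, J) with T unitary gives S^dagger J = J S^dagger. Hence A_ncno is
   unitarily similar to Y = -i J H with the Hermitian matrix H = S^dagger Omega S. Since
   -Y^dagger = -i H J = J Y J, the spectrum of Y is invariant under z |-> -z^*, and as A_ncno is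
   real, it is also invariant under conjugation. *)

theory Submission
  imports Defs
begin

section \<open>Algebra of the conjugate transpose\<close>

lemma mat_adjoint_dims [simp]:
  "dim_row (mat_adjoint A) = dim_col A" "dim_col (mat_adjoint A) = dim_row A"
  by (simp_all add: mat_adjoint_def)

lemma mat_adjoint_carrier [simp]:
  "A \<in> carrier_mat r c \<Longrightarrow> mat_adjoint A \<in> carrier_mat c r"
  by auto

lemma mat_adjoint_conv: "mat_adjoint A = map_mat cnj A\<^sup>T" for A :: "complex mat"
  by (rule eq_matI) (auto simp: mat_adjoint_def mat_of_rows_def)

lemma mat_adjoint_adjoint [simp]: "mat_adjoint (mat_adjoint A) = A" for A :: "complex mat"
  by (rule eq_matI) (auto simp: mat_adjoint_conv)

lemma map_mat_cnj_mult:
  assumes "A \<in> carrier_mat r k" "B \<in> carrier_mat k c"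
  shows "map_mat cnj (A * B) = map_mat cnj A * map_mat cnj B"
  using assms by (intro eq_matI) (auto simp: scalar_prod_def)

lemma mat_adjoint_mult:
  fixes A B :: "complex mat"
  assumes "A \<in> carrier_mat r k" "B \<in> carrier_mat k c"
  shows "mat_adjoint (A * B) = mat_adjoint B * mat_adjoint A"
  unfolding mat_adjoint_conv transpose_mult[OF assms]
  using assms by (intro map_mat_cnj_mult) auto

section \<open>Spectra under similarity, conjugation, adjoint and negation\<close>

lemma spectrum_iff_det:
  fixes A :: "'a :: field mat"
  assumes "A \<in> carrier_mat k k"
  shows "x \<in> spectrum A \<longleftrightarrow> det (char_matrix A x) = 0"
  using eigenvalue_det[OF assms] by (simp add: spectrum_def)

lemma spectrum_similar:
  fixes A B :: "'a :: field mat"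
  assumes "similar_mat A B"
  shows "spectrum A = spectrum B"
proof -
  from similar_matD[OF assms] obtain k P Q where "{A, B, P, Q} \<subseteq> carrier_mat k k"
    by blast
  then have "A \<in> carrier_mat k k" "B \<in> carrier_mat k k" by auto
  then show ?thesis
    by (simp add: spectrum_root_char_poly char_poly_similar[OF assms])
qed

text \<open>Conjugation is a ring homomorphism and hence commutes with the determinant, so a
  vanishing characteristic determinant at \<open>x\<close> is carried to one at
  \<open>cnj x\<close>.\<close>

lemma spectrum_cnj:
  assumes A: "A \<in> carrier_mat k k" and x: "x \<in> spectrum A"
  shows "cnj x \<in> spectrum (map_mat cnj A)"
proof -
  interpret cnj: comm_ring_hom cnj by unfold_locales auto
  have "char_matrix (map_mat cnj A) (cnj x) = map_mat cnj (char_matrix A x)"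
    using A by (intro eq_matI) (auto simp: char_matrix_def)
  then show ?thesis
    using A x by (simp add: spectrum_iff_det[of _ k])
qed

text \<open>A matrix and its transpose have the same characteristic polynomial; only the conjugation
  moves the eigenvalues.\<close>

lemma spectrum_mat_adjoint:
  assumes A: "A \<in> carrier_mat k k" and x: "x \<in> spectrum A"
  shows "cnj x \<in> spectrum (mat_adjoint A)"
proof -
  have "x \<in> spectrum A\<^sup>T"
    using A x by (simp add: spectrum_root_char_poly[of _ k])
  then show ?thesis
    using A unfolding mat_adjoint_conv by (intro spectrum_cnj[of _ k]) auto
qed

lemma spectrum_uminus:
  fixes A :: "'a :: field mat"
  assumes A: "A \<in> carrier_mat k k" and x: "x \<in> spectrum A"
  shows "- x \<in> spectrum (- A)"
proof -
  have "char_matrix (- A) (- x) = (- 1) \<cdot>\<^sub>m char_matrix A x"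
    using A by (intro eq_matI) (auto simp: char_matrix_def)
  then show ?thesis
    using A x by (simp add: spectrum_iff_det[of _ k])
qed

lemma spectrum_of_real_cnj:
  fixes R :: "real mat"
  assumes "R \<in> carrier_mat k k" "x \<in> spectrum (map_mat complex_of_real R)"
  shows "cnj x \<in> spectrum (map_mat complex_of_real R)"
proof -
  have "map_mat cnj (map_mat complex_of_real R) = map_mat complex_of_real R"
    by (intro eq_matI) auto
  then show ?thesis
    using spectrum_cnj[of "map_mat complex_of_real R" k x] assms by simp
qed

section \<open>The signature matrix J and Hamiltonian spectra\<close>

lemma J_mat_conv: "J_mat k = four_block_mat (1\<^sub>m k) (0\<^sub>m k k) (0\<^sub>m k k) (- 1\<^sub>m k)"
  unfolding J_mat_def by (simp add: Let_def) (rule eq_matI; auto)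

lemma J_mat_carrier [simp]: "J_mat k \<in> carrier_mat (2 * k) (2 * k)"
  unfolding J_mat_conv by (rule carrier_matI) simp_all

lemma J_mat_dims [simp]: "dim_row (J_mat k) = 2 * k" "dim_col (J_mat k) = 2 * k"
  by (rule carrier_matD[OF J_mat_carrier])+

lemma J_mat_adjoint [simp]: "mat_adjoint (J_mat k) = J_mat k"
  unfolding mat_adjoint_conv J_mat_conv by (rule eq_matI) auto

lemma J_mat_square [simp]: "J_mat k * J_mat k = 1\<^sub>m (2 * k)"
  unfolding J_mat_conv
  by (subst mult_four_block_mat[of _ k k _ k _ k _ _ k _ k])
     (simp_all, intro eq_matI, auto)

text \<open>Negating the adjoint moves an eigenvalue \<open>x\<close> to \<open>- cnj x\<close>.
  Because J is Hermitian with square 1, the negated adjoint of \<open>?Y\<close> is also the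
  conjugate of \<open>?Y\<close> by J, so it has the spectrum of \<open>?Y\<close>.\<close>

lemma spectrum_hamiltonian:
  assumes H: "H \<in> carrier_mat (2 * k) (2 * k)" "hermitian_mat H"
    and x: "x \<in> spectrum ((- \<i>) \<cdot>\<^sub>m (J_mat k * H))"
  shows "- cnj x \<in> spectrum ((- \<i>) \<cdot>\<^sub>m (J_mat k * H))"
proof -
  let ?J = "J_mat k" and ?Y = "(- \<i>) \<cdot>\<^sub>m (J_mat k * H)"
  have Y: "?Y \<in> carrier_mat (2 * k) (2 * k)"
    using H by auto
  have "mat_adjoint (?J * H) = H * ?J"
    using H mat_adjoint_mult[OF J_mat_carrier H(1)] by (simp add: hermitian_mat_def)
  \<comment> \<open>The adjoint turns the scalar -i into i, and the outer sign turns it back into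
    -i.\<close>
  moreover have "- mat_adjoint ?Y = (- \<i>) \<cdot>\<^sub>m mat_adjoint (?J * H)"
    unfolding mat_adjoint_conv by (rule eq_matI) auto
  ultimately have adj: "- mat_adjoint ?Y = (- \<i>) \<cdot>\<^sub>m (H * ?J)"
    by simp
  have "?J * ?Y * ?J = (- \<i>) \<cdot>\<^sub>m (H * ?J)"
  proof -
    have "?J * (?J * H) = H"
      using assoc_mult_mat[OF J_mat_carrier J_mat_carrier H(1)] H(1) by simp
    then have "?J * ?Y = (- \<i>) \<cdot>\<^sub>m H"
      using H(1) mult_smult_distrib[OF J_mat_carrier mult_carrier_mat[OF J_mat_carrier H(1)]]
      by simp
    then show ?thesis
      using mult_smult_assoc_mat[OF H(1) J_mat_carrier] by simp
  qed
  then have "similar_mat (- mat_adjoint ?Y) ?Y"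
    unfolding adj using Y H by (intro similar_matI[of _ _ ?J ?J "2 * k"]) auto
  moreover have "- cnj x \<in> spectrum (- mat_adjoint ?Y)"
    using Y x by (intro spectrum_uminus[of _ "2 * k"] spectrum_mat_adjoint) auto
  ultimately show ?thesis
    using spectrum_similar by blast
qed

section \<open>Block matrices and the quadrature transformation V\<close>

lemma append_cols_empty [simp]: "append_cols A (0\<^sub>m 0 0) = A"
  unfolding append_cols_def by (rule eq_matI) simp_all

lemma append_rows_empty [simp]: "append_rows A (0\<^sub>m 0 0) = A"
  unfolding append_rows_def by (rule eq_matI) simp_all

text \<open>With its row counterpart, this allows single entries of \<open>A_bar\<close> and
  \<open>C_bar\<close> to be read off from their block forms.\<close>

lemma append_cols_index:
  assumes "i < dim_row A" "j < dim_col A + dim_col B"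
  shows "append_cols A B $$ (i, j) =
    (if j < dim_col A then A $$ (i, j) else B $$ (i, j - dim_col A))"
  using assms unfolding append_cols_def by (subst index_mat_four_block) auto

lemma append_rows_index:
  assumes "i < dim_row A + dim_row B" "j < dim_col A"
  shows "append_rows A B $$ (i, j) =
    (if i < dim_row A then A $$ (i, j) else B $$ (i - dim_row A, j))"
  using assms unfolding append_rows_def by (subst index_mat_four_block) auto

lemma append_dims [simp]:
  "dim_row (append_cols A B) = dim_row A"
  "dim_col (append_cols A B) = dim_col A + dim_col B"
  "dim_row (append_rows A B) = dim_row A + dim_row B"
  "dim_col (append_rows A B) = dim_col A"
  by (simp_all add: append_cols_def append_rows_def)

text \<open>Brings \<open>V_mat\<close> into a form to which blockwise multiplication
  applies.\<close>

lemma block_mat_2_2: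
  assumes "dim_row B = dim_row A" "dim_col C = dim_col A"
    "dim_row D = dim_row C" "dim_col D = dim_col B"
  shows "block_mat [[A, B], [C, D]] = four_block_mat A B C D"
  using assms
  by (intro eq_matI) (auto simp: block_mat_def append_cols_index append_rows_index)

lemma V_mat_conv:
  "V_mat k = complex_of_real (1 / sqrt 2) \<cdot>\<^sub>m
     four_block_mat (1\<^sub>m k) (1\<^sub>m k) ((- \<i>) \<cdot>\<^sub>m 1\<^sub>m k) (\<i> \<cdot>\<^sub>m 1\<^sub>m k)"
  unfolding V_mat_def by (simp add: block_mat_2_2)

lemma V_mat_carrier [simp]: "V_mat k \<in> carrier_mat (2 * k) (2 * k)"
  unfolding V_mat_conv by (rule carrier_matI) simp_all

lemma V_mat_dims [simp]: "dim_row (V_mat k) = 2 * k" "dim_col (V_mat k) = 2 * k"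
  by (rule carrier_matD[OF V_mat_carrier])+

text \<open>In the product of the unscaled blocks the mixed terms i and -i cancel and each diagonal
  block is 1 + 1; the squared scalar 1/2 then normalizes the result.\<close>

lemma V_mat_unitary:
  "V_mat k * mat_adjoint (V_mat k) = 1\<^sub>m (2 * k)"
  "mat_adjoint (V_mat k) * V_mat k = 1\<^sub>m (2 * k)"
proof -
  let ?c = "complex_of_real (1 / sqrt 2)"
  let ?B = "four_block_mat (1\<^sub>m k) (1\<^sub>m k) ((- \<i>) \<cdot>\<^sub>m 1\<^sub>m k) (\<i> \<cdot>\<^sub>m 1\<^sub>m k)"
  let ?B' = "four_block_mat (1\<^sub>m k) (\<i> \<cdot>\<^sub>m 1\<^sub>m k) (1\<^sub>m k) ((- \<i>) \<cdot>\<^sub>m 1\<^sub>m k)"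
  have adj: "mat_adjoint (V_mat k) = ?c \<cdot>\<^sub>m ?B'"
    unfolding mat_adjoint_conv V_mat_conv by (rule eq_matI) auto
  have B: "?B \<in> carrier_mat (2 * k) (2 * k)" "?B' \<in> carrier_mat (2 * k) (2 * k)"
    by (rule carrier_matI; simp)+
  have "?B * ?B' = 2 \<cdot>\<^sub>m 1\<^sub>m (2 * k)"
    by (subst mult_four_block_mat[of _ k k _ k _ k _ _ k _ k], simp_all, rule eq_matI)
      (auto simp: mult_smult_distrib[of _ k k _ k] mult_smult_assoc_mat[of _ k k _ k])
  then have "(?c \<cdot>\<^sub>m ?B) * (?c \<cdot>\<^sub>m ?B') = (?c * ?c * 2) \<cdot>\<^sub>m 1\<^sub>m (2 * k)"
    unfolding mult_smult_assoc_mat[OF B(1) smult_carrier_mat[OF B(2)]]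
      mult_smult_distrib[OF B] by (intro eq_matI) auto
  moreover have "?c * ?c * 2 = 1"
    by (simp flip: of_real_mult)
  ultimately have "(?c \<cdot>\<^sub>m ?B) * (?c \<cdot>\<^sub>m ?B') = 1 \<cdot>\<^sub>m 1\<^sub>m (2 * k)"
    by (simp only:)
  also have "\<dots> = 1\<^sub>m (2 * k)"
    by (intro eq_matI) auto
  finally show "V_mat k * mat_adjoint (V_mat k) = 1\<^sub>m (2 * k)"
    unfolding adj by (simp only: V_mat_conv)
  \<comment> \<open>For square matrices a one-sided inverse is two-sided.\<close>
  then show "mat_adjoint (V_mat k) * V_mat k = 1\<^sub>m (2 * k)"
    by (rule mat_mult_left_right_inverse[rotated 2]) auto
qed

section \<open>Extraction of the last coordinates\<close>

text \<open>Multiplication with this isometry extracts the blocks of the last \<open>q\<close> coordinates, which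
  avoids decomposing every matrix by \<open>four_block_mat\<close>.\<close>

definition last_coords :: "nat \<Rightarrow> nat \<Rightarrow> complex mat" where
  "last_coords p q = mat (p + q) q (\<lambda>(i, j). if i = p + j then 1 else 0)"

lemma last_coords_carrier [simp]: "last_coords p q \<in> carrier_mat (p + q) q"
  by (simp add: last_coords_def)

lemma mult_last_coords:
  assumes "M \<in> carrier_mat r (p + q)"
  shows "M * last_coords p q = mat r q (\<lambda>(i, j). M $$ (i, p + j))"
proof (rule eq_matI)
  fix i j
  assume "i < dim_row (mat r q (\<lambda>(i, j). M $$ (i, p + j)))"
    and "j < dim_col (mat r q (\<lambda>(i, j). M $$ (i, p + j)))"
  then have ij: "i < r" "j < q" by auto
  have "col (last_coords p q) j = unit_vec (p + q) (p + j)"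
    using ij by (intro eq_vecI) (auto simp: last_coords_def)
  then have "(M * last_coords p q) $$ (i, j) = row M i \<bullet> unit_vec (p + q) (p + j)"
    using assms ij by (simp add: last_coords_def)
  also have "\<dots> = M $$ (i, p + j)"
    using assms ij by (subst scalar_prod_right_unit) auto
  finally show "(M * last_coords p q) $$ (i, j) = mat r q (\<lambda>(i, j). M $$ (i, p + j)) $$ (i, j)"
    using ij by simp
qed (use assms in \<open>auto simp: last_coords_def\<close>)

text \<open>The row version follows from the column version by taking adjoints; the two conjugations
  of each entry cancel.\<close>

lemma adjoint_last_coords_mult:
  assumes "M \<in> carrier_mat (p + q) c"
  shows "mat_adjoint (last_coords p q) * M = mat q c (\<lambda>(i, j). M $$ (p + i, j))"
proof -
  have "mat_adjoint (last_coords p q) * M = mat_adjoint (mat_adjoint M * last_coords p q)"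
    using mat_adjoint_mult[of "mat_adjoint M" c "p + q" "last_coords p q" q] assms by simp
  also have "\<dots> = mat q c (\<lambda>(i, j). M $$ (p + i, j))"
    using assms by (subst mult_last_coords[of _ c]) (auto simp: mat_adjoint_conv intro!: eq_matI)
  finally show ?thesis .
qed

text \<open>A block diagonal matrix maps the last coordinates to themselves and acts there as
  \<open>Q\<close>. In this intertwining form, the canonical transformations can be moved past the
  isometry without splitting \<open>T\<close>.\<close>

lemma diag_block_mult_last_coords:
  assumes "P \<in> carrier_mat p p" "Q \<in> carrier_mat q q"
  shows "four_block_mat P (0\<^sub>m p q) (0\<^sub>m q p) Q * last_coords p q = last_coords p q * Q"
proof (rule eq_matI)
  fix i j
  assume "i < dim_row (last_coords p q * Q)" "j < dim_col (last_coords p q * Q)"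
  then have ij: "i < p + q" "j < q"
    using assms by (auto simp: last_coords_def)
  have "row (last_coords p q) i = (if i < p then 0\<^sub>v q else unit_vec q (i - p))"
    using ij by (intro eq_vecI) (auto simp: last_coords_def)
  \<comment> \<open>The rewrite rule below supplies only the row dimension: unfolding
    \<open>last_coords\<close> fully would hide the term to which the fact about \<open>row\<close>
    applies.\<close>
  then have "(last_coords p q * Q) $$ (i, j) = (if i < p then 0 else Q $$ (i - p, j))"
    using assms ij by (auto simp: last_coords_def[THEN arg_cong, of dim_row])
  then show "(four_block_mat P (0\<^sub>m p q) (0\<^sub>m q p) Q * last_coords p q) $$ (i, j) =
      (last_coords p q * Q) $$ (i, j)"
    using assms ij by (subst mult_last_coords[of _ "p + q"]) auto
qed (use assms in \<open>auto simp: last_coords_def\<close>)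

lemma adjoint_diag_block_mult_last_coords:
  assumes "P \<in> carrier_mat p p" "Q \<in> carrier_mat q q"
  shows "mat_adjoint (four_block_mat P (0\<^sub>m p q) (0\<^sub>m q p) Q) * last_coords p q =
    last_coords p q * mat_adjoint Q"
proof -
  have "mat_adjoint (four_block_mat P (0\<^sub>m p q) (0\<^sub>m q p) Q) =
      four_block_mat (mat_adjoint P) (0\<^sub>m p q) (0\<^sub>m q p) (mat_adjoint Q)"
    using assms unfolding mat_adjoint_conv by (intro eq_matI) auto
  then show ?thesis
    using assms by (simp add: diag_block_mult_last_coords)
qed

text \<open>\<open>diag_block_mat\<close> recurses by splitting off the first block, whereas the
  splitting into p + q coordinates needs the last block to be separate.\<close>

lemma diag_block_mat_3:
  assumes "P \<in> carrier_mat a a" "Q \<in> carrier_mat b b" "R \<in> carrier_mat c c"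
  shows "diag_block_mat [P, Q, R] =
    four_block_mat (diag_block_mat [P, Q]) (0\<^sub>m (a + b) c) (0\<^sub>m c (a + b)) R"
  using diag_block_mat_last[of "[P, Q]" R] assms by (simp add: Let_def)

lemma Pi_mat_carrier [simp]: "Pi_mat na nb \<in> carrier_mat (2 * (na + nb)) (2 * (na + nb))"
  by (rule carrier_matI) (simp_all add: Pi_mat_def block_mat_def)

lemma kalman_T_carrier:
  assumes "Z1 \<in> carrier_mat n n1" "Z2 \<in> carrier_mat n n2" "Z3 \<in> carrier_mat n n3"
  shows "kalman_T n n1 n2 n3 Z1 Z2 Z3 \<in> carrier_mat (2 * n) (2 * (n1 + n2 + n3))"
  using assms
  by (intro carrier_matI) (auto simp: kalman_T_def block_mat_def)

section \<open>Compression of the system matrix to a subspace on which the output vanishes\<close>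

text \<open>The relation \<open>CS\<close> removes the dissipative term and \<open>SJ\<close> moves
  J to the left of the compression. What remains is J times a congruence of \<open>H\<close>, which
  stays Hermitian.\<close>

lemma compression_hamiltonian:
  assumes H: "H \<in> carrier_mat (2 * n) (2 * n)" "hermitian_mat H"
    and C: "C \<in> carrier_mat (2 * m) (2 * n)"
    and S: "S \<in> carrier_mat (2 * n) (2 * k)"
    and CS: "C * S = 0\<^sub>m (2 * m) (2 * k)"
    and SJ: "mat_adjoint S * J_mat n = J_mat k * mat_adjoint S"
  shows "mat_adjoint S * (qls_A n H C * S) =
      (- \<i>) \<cdot>\<^sub>m (J_mat k * (mat_adjoint S * (H * S)))"
    and "mat_adjoint S * (H * S) \<in> carrier_mat (2 * k) (2 * k)"
    and "hermitian_mat (mat_adjoint S * (H * S))"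
proof -
  have S': "mat_adjoint S \<in> carrier_mat (2 * k) (2 * n)"
    using S by simp
  have HS: "H * S \<in> carrier_mat (2 * n) (2 * k)"
    using H S by simp
  have flat: "flat C \<in> carrier_mat (2 * n) (2 * m)"
    unfolding flat_def using C by (intro carrier_matI) auto
  have JH: "J_mat n * H \<in> carrier_mat (2 * n) (2 * n)"
    using H(1) by (rule mult_carrier_mat[OF J_mat_carrier])
  have "(flat C * C) * S = 0\<^sub>m (2 * n) (2 * k)"
    using flat by (simp add: assoc_mult_mat[OF flat C S] CS)
  then have "qls_A n H C * S = (- \<i>) \<cdot>\<^sub>m (J_mat n * H * S)"
    unfolding qls_A_def
    using JH S flat C mult_carrier_mat[OF JH S]
    by (subst minus_mult_distrib_mat[of _ "2 * n" "2 * n" _ _ "2 * k"])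
      (auto simp: mult_smult_assoc_mat[of _ "2 * n" "2 * n" _ "2 * k"] intro!: eq_matI)
  also have "J_mat n * H * S = J_mat n * (H * S)"
    by (rule assoc_mult_mat[OF J_mat_carrier H(1) S])
  finally have "mat_adjoint S * (qls_A n H C * S) =
      (- \<i>) \<cdot>\<^sub>m (mat_adjoint S * (J_mat n * (H * S)))"
    using mult_smult_distrib[OF S' mult_carrier_mat[OF J_mat_carrier HS]] by simp
  also have "mat_adjoint S * (J_mat n * (H * S)) = mat_adjoint S * J_mat n * (H * S)"
    by (rule assoc_mult_mat[OF S' J_mat_carrier HS, symmetric])
  also have "\<dots> = J_mat k * (mat_adjoint S * (H * S))"
    unfolding SJ by (rule assoc_mult_mat[OF J_mat_carrier S' HS])
  finally show "mat_adjoint S * (qls_A n H C * S) =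
      (- \<i>) \<cdot>\<^sub>m (J_mat k * (mat_adjoint S * (H * S)))" .
  show "mat_adjoint S * (H * S) \<in> carrier_mat (2 * k) (2 * k)"
    by (rule mult_carrier_mat[OF S' HS])
  show "hermitian_mat (mat_adjoint S * (H * S))"
    using H(2) assoc_mult_mat[OF S' H(1) S]
    by (simp add: hermitian_mat_def mat_adjoint_mult[OF S' HS] mat_adjoint_mult[OF H(1) S])
qed

section \<open>Application to the Kalman canonical form\<close>

theorem proposition3p2:
  fixes m n n1 n2 n3 na nb :: nat
    and \<Delta> :: "complex mat \<Rightarrow> complex mat \<Rightarrow> complex mat"
    and Cminus Cplus Ominus Oplus C \<Omega> A B Z1 Z2 Z3 T T_hat :: "complex mat"
    and A_bar B_bar C_bar :: "real mat"
    and Ah11 Ah12 A12 A13 Ah22 A21 A_co A31 A_ncno Bh B_co Ch C_co :: "real mat"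
    and lam :: complex
  assumes n: "n = n1 + n2 + n3" and n3: "n3 = na + nb"
    \<comment> \<open>quantum linear system\<close>
    and Delta: "\<Delta> = Delta \<or> \<Delta> = Delta_doubled"
    and Cminus: "Cminus \<in> carrier_mat m n" and Cplus: "Cplus \<in> carrier_mat m n"
    and Ominus: "Ominus \<in> carrier_mat n n" and Oplus: "Oplus \<in> carrier_mat n n"
    and C: "C = \<Delta> Cminus Cplus"
    and Omega: "\<Omega> = \<Delta> Ominus Oplus" "hermitian_mat \<Omega>"
    and A: "A = qls_A n \<Omega> C" and B: "B = qls_B C"
    \<comment> \<open>Kalman canonical form\<close>
    and Z1: "Z1 \<in> carrier_mat n n1" and Z2: "Z2 \<in> carrier_mat n n2"
    and Z3: "Z3 \<in> carrier_mat n n3"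
    and T: "T = kalman_T n n1 n2 n3 Z1 Z2 Z3"
    and T_unitary: "unitary_mat T"
    and T_J: "mat_adjoint T * J_mat n * T = diag_block_mat [J_mat n3, J_mat n1, J_mat n2]"
    and T_hat: "T_hat = T * mat_adjoint (V_tilde n1 n2 na nb)"
    and A_bar: "map_mat complex_of_real A_bar = mat_adjoint T_hat * A * T_hat"
    and B_bar: "map_mat complex_of_real B_bar = mat_adjoint T_hat * B * mat_adjoint (V_mat m)"
    and C_bar: "map_mat complex_of_real C_bar = V_mat m * C * T_hat"
    and A_bar_dims:
      "Ah11 \<in> carrier_mat n3 n3" "Ah12 \<in> carrier_mat n3 n3"
      "A12 \<in> carrier_mat n3 (2 * n1)" "A13 \<in> carrier_mat n3 (2 * n2)"
      "Ah22 \<in> carrier_mat n3 n3"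
      "A21 \<in> carrier_mat (2 * n1) n3" "A_co \<in> carrier_mat (2 * n1) (2 * n1)"
      "A31 \<in> carrier_mat (2 * n2) n3" "A_ncno \<in> carrier_mat (2 * n2) (2 * n2)"
    and A_bar_blocks:
      "A_bar = block_mat
         [[Ah11,               Ah12, A12,                   A13],
          [0\<^sub>m n3 n3,         Ah22, 0\<^sub>m n3 (2*n1),       0\<^sub>m n3 (2*n2)],
          [0\<^sub>m (2*n1) n3,     A21,  A_co,                  0\<^sub>m (2*n1) (2*n2)],
          [0\<^sub>m (2*n2) n3,     A31,  0\<^sub>m (2*n2) (2*n1),   A_ncno]]"
    and B_bar_dims: "Bh \<in> carrier_mat n3 (2 * m)" "B_co \<in> carrier_mat (2 * n1) (2 * m)"
    and B_bar_blocks: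
      "B_bar = block_mat [[Bh], [0\<^sub>m n3 (2*m)], [B_co], [0\<^sub>m (2*n2) (2*m)]]"
    and C_bar_dims: "Ch \<in> carrier_mat (2 * m) n3" "C_co \<in> carrier_mat (2 * m) (2 * n1)"
    and C_bar_blocks:
      "C_bar = block_mat [[0\<^sub>m (2*m) n3, Ch, C_co, 0\<^sub>m (2*m) (2*n2)]]"
    and controllable:
      "controllable_subspace A_bar B_bar =
         coordinate_subspace (2*n) ({0..<n3} \<union> {2*n3..<2*n3 + 2*n1})"
    and unobservable:
      "unobservable_subspace A_bar C_bar =
         coordinate_subspace (2*n) ({0..<n3} \<union> {2*n3 + 2*n1..<2*n})"
    and lam: "lam \<in> spectrum (map_mat complex_of_real A_ncno)"
  shows "- lam \<in> spectrum (map_mat complex_of_real A_ncno) \<and>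
         cnj lam \<in> spectrum (map_mat complex_of_real A_ncno) \<and>
         - cnj lam \<in> spectrum (map_mat complex_of_real A_ncno)"
proof -
  let ?V = "V_mat n2"
  \<comment> \<open>The first \<open>p\<close> coordinates comprise both h parts and the co part;
    the last \<open>q\<close> form the subsystem under study.\<close>
  define p q where "p = 2 * n3 + 2 * n1" and "q = 2 * n2"
  define E where "E = last_coords p q"
  define S where "S = T * E"
  have N: "2 * n = p + q"
    using n by (simp add: p_def q_def)
  have E_carrier: "E \<in> carrier_mat (2 * n) q"
    unfolding E_def N by simp
  have T_carrier: "T \<in> carrier_mat (2 * n) (2 * n)"
    using kalman_T_carrier[OF Z1 Z2 Z3] n unfolding T by simp
  \<comment> \<open>Both conventions for \<Delta> yield the same dimensions, since they differ only
    in the order of the lower blocks.\<close>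
  have C_carrier: "C \<in> carrier_mat (2 * m) (2 * n)"
    using Delta Cminus Cplus unfolding C
    by (intro carrier_matI) (auto simp: Delta_def Delta_doubled_def)
  have \<Omega>_carrier: "\<Omega> \<in> carrier_mat (2 * n) (2 * n)"
    using Delta Ominus Oplus unfolding Omega(1)
    by (intro carrier_matI) (auto simp: Delta_def Delta_doubled_def)
  have S_carrier: "S \<in> carrier_mat (2 * n) q"
    unfolding S_def by (rule mult_carrier_mat[OF T_carrier E_carrier])
  have V: "?V \<in> carrier_mat q q" "mat_adjoint ?V \<in> carrier_mat q q"
    by (simp_all add: q_def)
  have SV_carrier: "S * mat_adjoint ?V \<in> carrier_mat (2 * n) q"
    by (rule mult_carrier_mat[OF S_carrier V(2)])
  have A_carrier: "A \<in> carrier_mat (2 * n) (2 * n)"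
    using C_carrier \<Omega>_carrier unfolding A qls_A_def flat_def
    by (intro carrier_matI) auto

  let ?W = "V_tilde n1 n2 na nb"
  let ?W1 = "diag_block_mat [Pi_mat na nb * V_mat n3, V_mat n1]"
  have PV: "Pi_mat na nb * V_mat n3 \<in> carrier_mat (2 * n3) (2 * n3)"
    unfolding n3 by (rule mult_carrier_mat[OF Pi_mat_carrier V_mat_carrier])
  have W: "?W = four_block_mat ?W1 (0\<^sub>m p q) (0\<^sub>m q p) ?V"
    unfolding V_tilde_def p_def q_def n3[symmetric] by (rule diag_block_mat_3[OF PV]) simp_all
  have W1: "?W1 \<in> carrier_mat p p"
    using carrier_matD[OF PV] by (intro carrier_matI) (simp_all add: dim_diag_block_mat p_def)
  have W_carrier: "mat_adjoint ?W \<in> carrier_mat (2 * n) (2 * n)"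
    using W1 V unfolding W N by (intro mat_adjoint_carrier four_block_carrier_mat)
  have T_hat_carrier: "T_hat \<in> carrier_mat (2 * n) (2 * n)"
    unfolding T_hat by (rule mult_carrier_mat[OF T_carrier W_carrier])
  \<comment> \<open>On the last coordinates the adjoint of \<open>V_tilde\<close> acts as that of
    \<open>V_mat n2\<close>, so \<open>T_hat\<close> and \<open>T\<close> differ there only by this
    unitary factor.\<close>
  have "mat_adjoint ?W * E = E * mat_adjoint ?V"
    unfolding W E_def by (rule adjoint_diag_block_mult_last_coords[OF W1 V(1)])
  then have T_hat_E: "T_hat * E = S * mat_adjoint ?V"
    unfolding T_hat S_def
    by (simp add: assoc_mult_mat[OF T_carrier W_carrier E_carrier]
        assoc_mult_mat[OF T_carrier E_carrier V(2)])

  let ?D = "diag_block_mat [J_mat n3, J_mat n1, J_mat n2]"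
  have D: "?D = four_block_mat (diag_block_mat [J_mat n3, J_mat n1]) (0\<^sub>m p q) (0\<^sub>m q p) (J_mat n2)"
    unfolding p_def q_def by (rule diag_block_mat_3) simp_all
  have D_carrier: "?D \<in> carrier_mat (2 * n) (2 * n)"
    using n by (intro carrier_matI) (simp_all add: dim_diag_block_mat)
  have DE: "?D * E = E * J_mat n2"
    unfolding D E_def
    by (rule diag_block_mult_last_coords) (auto intro: carrier_matI simp: dim_diag_block_mat p_def q_def)
  have TT: "T * mat_adjoint T = 1\<^sub>m (2 * n)"
    using T_unitary T_carrier by (simp add: unitary_mat_def inverts_mat_def)
  have T': "mat_adjoint T \<in> carrier_mat (2 * n) (2 * n)"
    using T_carrier by simp
  have JT: "J_mat n * T \<in> carrier_mat (2 * n) (2 * n)"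
    by (rule mult_carrier_mat[OF J_mat_carrier T_carrier])
  \<comment> \<open>Multiplying \<open>T_J\<close> by \<open>T\<close> from the left and using
    unitarity gives an intertwining relation, which can be restricted to columns.\<close>
  have "T * ?D = T * (mat_adjoint T * (J_mat n * T))"
    unfolding T_J[symmetric] by (simp only: assoc_mult_mat[OF T' J_mat_carrier T_carrier])
  also have "\<dots> = J_mat n * T"
    using JT by (simp only: assoc_mult_mat[OF T_carrier T' JT, symmetric] TT left_mult_one_mat)
  finally have TD: "T * ?D = J_mat n * T" .
  have "J_mat n * S = T * ?D * E"
    unfolding S_def TD by (rule assoc_mult_mat[OF J_mat_carrier T_carrier E_carrier, symmetric])
  also have "\<dots> = S * J_mat n2"
    unfolding S_def assoc_mult_mat[OF T_carrier D_carrier E_carrier] DE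
    using T_carrier E_carrier by (intro assoc_mult_mat[symmetric]) (auto simp: q_def)
  finally have JS: "J_mat n * S = S * J_mat n2" .
  have S': "mat_adjoint S \<in> carrier_mat q (2 * n)"
    using S_carrier by simp
  \<comment> \<open>This is the adjoint of \<open>JS\<close>, since both J matrices are
    Hermitian.\<close>
  have SJ: "mat_adjoint S * J_mat n = J_mat n2 * mat_adjoint S"
    using arg_cong[OF JS, of mat_adjoint] S_carrier
      mat_adjoint_mult[OF J_mat_carrier S_carrier]
      mat_adjoint_mult[of S "2 * n" q "J_mat n2" q]
    by (simp add: q_def)

  have CS_carrier: "C * S \<in> carrier_mat (2 * m) q"
    by (rule mult_carrier_mat[OF C_carrier S_carrier])
  have CSV: "C * S * mat_adjoint ?V \<in> carrier_mat (2 * m) q"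
    by (rule mult_carrier_mat[OF CS_carrier V(2)])
  have "C_bar \<in> carrier_mat (2 * m) (2 * n)"
    using C_bar_dims n by (intro carrier_matI) (auto simp: C_bar_blocks block_mat_def)
  \<comment> \<open>The last block of \<open>C_bar\<close> is zero. Expressed through
    \<open>S\<close> it is C S between the unitary factors \<open>V_mat m\<close> and the adjoint of
    \<open>?V\<close>, which are cancelled below to give C S = 0.\<close>
  moreover have "C_bar $$ (i, p + j) = 0" if "i < 2 * m" "j < q" for i j
    using that C_bar_dims
    by (simp add: C_bar_blocks block_mat_def append_cols_index p_def q_def)
  ultimately have "map_mat complex_of_real C_bar * E = 0\<^sub>m (2 * m) q"
    unfolding E_def by (subst mult_last_coords[of _ "2 * m"]) (auto simp: N)
  then have "V_mat m * C * T_hat * E = 0\<^sub>m (2 * m) q"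
    unfolding C_bar .
  moreover have "V_mat m * C * T_hat * E = V_mat m * (C * S * mat_adjoint ?V)"
    unfolding assoc_mult_mat[OF mult_carrier_mat[OF V_mat_carrier C_carrier] T_hat_carrier E_carrier]
      T_hat_E assoc_mult_mat[OF C_carrier S_carrier V(2)]
    by (rule assoc_mult_mat[OF V_mat_carrier C_carrier SV_carrier])
  ultimately have "mat_adjoint (V_mat m) * (V_mat m * (C * S * mat_adjoint ?V)) * ?V =
      mat_adjoint (V_mat m) * 0\<^sub>m (2 * m) q * ?V"
    by simp
  also have "mat_adjoint (V_mat m) * (V_mat m * (C * S * mat_adjoint ?V)) = C * S * mat_adjoint ?V"
    unfolding assoc_mult_mat[OF mat_adjoint_carrier[OF V_mat_carrier] V_mat_carrier CSV, symmetric]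
      V_mat_unitary(2) by (rule left_mult_one_mat[OF CSV])
  also have "C * S * mat_adjoint ?V * ?V = C * S"
    unfolding assoc_mult_mat[OF CS_carrier V(2) V(1)] V_mat_unitary(2) q_def[symmetric]
    by (rule right_mult_one_mat[OF CS_carrier])
  also have "mat_adjoint (V_mat m) * 0\<^sub>m (2 * m) q * ?V = 0\<^sub>m (2 * m) q"
    by (simp add: left_mult_zero_mat[OF V(1)])
  finally have CS: "C * S = 0\<^sub>m (2 * m) (2 * n2)"
    by (simp add: q_def)

  let ?H = "mat_adjoint S * (\<Omega> * S)"
  let ?Y = "(- \<i>) \<cdot>\<^sub>m (J_mat n2 * ?H)"
  note compr = compression_hamiltonian[OF \<Omega>_carrier Omega(2) C_carrier
      S_carrier[unfolded q_def] CS SJ, folded A]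
  let ?X = "map_mat complex_of_real A_ncno"
  have A_bar_carrier: "A_bar \<in> carrier_mat (2 * n) (2 * n)"
    using A_bar_dims n by (intro carrier_matI) (auto simp: A_bar_blocks block_mat_def)
  have A_bar_index: "A_bar $$ (p + i, p + j) = A_ncno $$ (i, j)" if "i < q" "j < q" for i j
    using that A_bar_dims
    by (simp add: A_bar_blocks block_mat_def append_cols_index append_rows_index p_def q_def)
  \<comment> \<open>\<open>A_ncno\<close> is the lower right block of \<open>A_bar\<close>, so the
    isometry is applied on both sides.\<close>
  have "?X = mat_adjoint E * (map_mat complex_of_real A_bar * E)"
    unfolding E_def using A_bar_carrier A_bar_dims A_bar_index
    by (subst mult_last_coords[of _ "2 * n"], simp add: N,
        subst adjoint_last_coords_mult[of _ p q q])
      (auto simp: N q_def)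
  also have "\<dots> = mat_adjoint (T_hat * E) * (A * (T_hat * E))"
  proof -
    have T_hat': "mat_adjoint T_hat \<in> carrier_mat (2 * n) (2 * n)"
      and E': "mat_adjoint E \<in> carrier_mat q (2 * n)"
      using T_hat_carrier E_carrier by simp_all
    have TE: "T_hat * E \<in> carrier_mat (2 * n) q"
      by (rule mult_carrier_mat[OF T_hat_carrier E_carrier])
    show ?thesis
      unfolding A_bar assoc_mult_mat[OF mult_carrier_mat[OF T_hat' A_carrier] T_hat_carrier E_carrier]
        assoc_mult_mat[OF T_hat' A_carrier TE] mat_adjoint_mult[OF T_hat_carrier E_carrier]
      by (rule assoc_mult_mat[OF E' T_hat' mult_carrier_mat[OF A_carrier TE], symmetric])
  qed
  \<comment> \<open>Substituting \<open>T_hat_E\<close> leaves only \<open>?V\<close> around the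
    compression of \<open>A\<close> to the columns of \<open>S\<close>.\<close>
  also have "\<dots> = ?V * (mat_adjoint S * (A * S)) * mat_adjoint ?V"
  proof -
    have AS: "A * S \<in> carrier_mat (2 * n) q"
      by (rule mult_carrier_mat[OF A_carrier S_carrier])
    show ?thesis
      unfolding T_hat_E mat_adjoint_mult[OF S_carrier V(2)] mat_adjoint_adjoint
        assoc_mult_mat[OF A_carrier S_carrier V(2), symmetric]
        assoc_mult_mat[OF V(1) S' mult_carrier_mat[OF AS V(2)]]
        assoc_mult_mat[OF S' AS V(2), symmetric]
      by (rule assoc_mult_mat[OF V(1) mult_carrier_mat[OF S' AS] V(2), symmetric])
  qed
  also have "\<dots> = ?V * ?Y * mat_adjoint ?V"
    unfolding compr(1) ..
  finally have X: "?X = ?V * ?Y * mat_adjoint ?V" .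
  have "?Y \<in> carrier_mat (2 * n2) (2 * n2)"
    by (rule smult_carrier_mat[OF mult_carrier_mat[OF J_mat_carrier compr(2)]])
  then have "similar_mat ?X ?Y"
    using A_bar_dims(9)
    by (intro similar_matI[OF _ V_mat_unitary X]) simp
  then have spectrum: "spectrum ?X = spectrum ?Y"
    by (rule spectrum_similar)
  \<comment> \<open>This is the reflection in the imaginary axis, obtained for \<open>?Y\<close> and
    transported by similarity. The reflection in the real axis below comes instead from
    \<open>A_ncno\<close> being real.\<close>
  have neg: "- cnj x \<in> spectrum ?X" if "x \<in> spectrum ?X" for x
    using that spectrum_hamiltonian[OF compr(2,3)] unfolding spectrum by blast
  have conj: "cnj x \<in> spectrum ?X" if "x \<in> spectrum ?X" for x
    using spectrum_of_real_cnj[OF A_bar_dims(9) that] .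
  show ?thesis
    \<comment> \<open>Composing the two reflections gives the point reflection, that is, the
      eigenvalue \<open>- lam\<close>.\<close>
    using neg[OF conj[OF lam]] conj[OF lam] neg[OF lam] by simp
qed

end
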